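(* Let $n\ge 0$ be an integer with $n\not\equiv 4\pmod 7$. For a $4$-core partition $\lambda$ of $7n+2$ with $4$-abacus $(0,a_1,a_2,a_3)$, set $b_j=4a_j+j$ for $j=1,2,3$, order the indices as $\{j_1,j_2,j_3\}=\{1,2,3\}$ with $b_{j_1}<b_{j_2}<b_{j_3}$, and let \[ \mathcal{C}=\Big\{ b_{j_2},\ b_{j_3},\ b_{j_2}-b_{j_1},\ b_{j_3}-b_{j_1},\ \tfrac{b_{j_2}+b_{j_3}-b_{j_1}}{2},\ b_{j_2}+b_{j_3}-b_{j_1}\Big\}. \] Then the six elements of $\mathcal{C}$ are integers, pairwise distinct and nonzero modulo $7$; writing $c_i$ for the unique element of $\mathcal{C}$ congruent to $i\pmod 7$ ($1\le i\le 6$), the tuple \[ \varphi(\lambda)=\Big(0,\big\lfloor \tfrac{c_1}{7}\big\rfloor,\big\lfloor \tfrac{c_2}{7}\big\rfloor,\big\lfloor \tfrac{c_3}{7}\big\rfloor,\big\lfloor \tfrac{c_4}{7}\big\rfloor,\big\lfloor \tfrac{c_5}{7}\big\rfloor,\big\lfloor \tfrac{c_6}{7}\big\rfloor\Big) \] is the $7$-abacus of a self-conjugate $7$-core partition of $8n+1$, and the resulting map $\varphi\colon C_4(7n+2)\to SC_7(8n+1)$ is two-to-one (every element of $SC_7(8n+1)$ has exactly two preimages).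
   Context: For a partition $\lambda=(\lambda_1\ge\dots\ge\lambda_s>0)$ with $s$ parts, the structure numbers are $B_j=\lambda_j-j+s$. For a $t$-core (a partition none of whose hook lengths is divisible by $t$), letting $m_c$ be the number of structure numbers congruent to $c$ modulo $t$, one has $m_0=0$ and the structure numbers congruent to $c$ are exactly $c,c+t,\dots,c+(m_c-1)t$; the tuple $(0,m_1,\dots,m_{t-1})$ is the $t$-abacus of $\lambda$ and determines $\lambda$ uniquely (conversely every such tuple of nonnegative integers is the abacus of a $t$-core). $C_4(m)$ is the set of $4$-cores of $m$ and $SC_7(m)$ the set of self-conjugate $7$-cores of $m$ (self-conjugate meaning equal to its conjugate). *)

theory Defs
  imports Complex_Main "HOL-Number_Theory.Cong"
begin

text \<open>
  Partitions are weakly decreasing lists of positive integers. Lists are indexed from 0, so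
  \<open>p ! i\<close> is the part usually written with index \<open>i + 1\<close>, and the boxes of the Young diagram are
  the pairs \<open>(i, j)\<close> with \<open>i < length p\<close> and \<open>j < p ! i\<close>.
\<close>

definition partition_of :: "nat \<Rightarrow> nat list \<Rightarrow> bool" where
  "partition_of m p \<longleftrightarrow> sorted_wrt (\<ge>) p \<and> 0 \<notin> set p \<and> sum_list p = m"

definition conjugate :: "nat list \<Rightarrow> nat list" where
  "conjugate p =
     (case p of [] \<Rightarrow> [] | k # _ \<Rightarrow> map (\<lambda>j. length (filter (\<lambda>q. j < q) p)) [0..<k])"

text \<open>Arm plus leg plus one; the subtractions do not truncate when \<open>(i, j)\<close> is a box.\<close>

definition hook_length :: "nat list \<Rightarrow> nat \<Rightarrow> nat \<Rightarrow> nat" where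
  "hook_length p i j = (p ! i - Suc j) + (conjugate p ! j - Suc i) + 1"

definition is_core :: "nat \<Rightarrow> nat list \<Rightarrow> bool" where
  "is_core t p \<longleftrightarrow> (\<forall>i < length p. \<forall>j < p ! i. \<not> t dvd hook_length p i j)"

definition cores :: "nat \<Rightarrow> nat \<Rightarrow> nat list set" where
  "cores t m = {p. partition_of m p \<and> is_core t p}"

definition sc_cores :: "nat \<Rightarrow> nat \<Rightarrow> nat list set" where
  "sc_cores t m = {p \<in> cores t m. conjugate p = p}"

text \<open>
  The addition precedes the subtraction so that nothing truncates. The structure numbers of a
  partition are pairwise distinct, so no multiplicity is lost by taking a set.
\<close>

definition structure_numbers :: "nat list \<Rightarrow> nat set" where
  "structure_numbers p = {p ! i + length p - Suc i | i. i < length p}"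

definition abacus :: "nat \<Rightarrow> nat list \<Rightarrow> nat list" where
  "abacus t p = map (\<lambda>c. card {x \<in> structure_numbers p. x mod t = c}) [0..<t]"

definition b_val :: "nat list \<Rightarrow> nat \<Rightarrow> nat" where
  "b_val p j = 4 * (abacus 4 p ! j) + j"

text \<open>
  The family of six elements, as a list of rationals because of the division by 2. The three
  numbers that are sorted have different residues modulo 4, so they are distinct.
\<close>

definition C_elems :: "nat list \<Rightarrow> rat list" where
  "C_elems p =
     (let bs = map of_nat (sort [b_val p 1, b_val p 2, b_val p 3]);
          x = bs ! 0; y = bs ! 1; z = bs ! 2
      in [y, z, y - x, z - x, (y + z - x) / 2, y + z - x])"

text \<open>
  Congruence modulo 7 is not meaningful on the field of rationals, so it is taken after applying
  the floor, which is the identity on the elements that occur since they are integers.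
\<close>

definition c_elem :: "nat list \<Rightarrow> nat \<Rightarrow> rat" where
  "c_elem p i = (THE c. c \<in> set (C_elems p) \<and> [\<lfloor>c\<rfloor> = int i] (mod 7))"

definition phi_tuple :: "nat list \<Rightarrow> int list" where
  "phi_tuple p = 0 # map (\<lambda>i. \<lfloor>c_elem p i / 7\<rfloor>) [1..<7]"

text \<open>The 7-core with abacus \<open>phi_tuple p\<close>; its size and self-conjugacy are not built in.\<close>

definition phi :: "nat list \<Rightarrow> nat list" where
  "phi p = (THE \<mu>. (\<exists>m. \<mu> \<in> cores 7 m) \<and> map int (abacus 7 \<mu>) = phi_tuple p)"

end

theory Submission
  imports Defs
begin

text \<open>
  A \<open>t\<close>-core is determined by the set \<open>G\<close> of its \<open>t\<close> first gaps \<open>t m\<^sub>c + c\<close>. Its size is a quadratic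
  function of \<open>G\<close>, namely \<open>t \<Sum>g\<^sup>2 - (\<Sum>g)\<^sup>2\<close> up to normalisation, and the core is self-conjugate iff \<open>G\<close> is
  invariant under some reflection \<open>g \<mapsto> T - g\<close>. The first gaps of a 4-core can be written as
  \<open>0, \<beta> + \<gamma>, \<alpha> + \<gamma>, \<alpha> + \<beta>\<close> with \<open>\<bar>\<gamma>\<bar> < \<beta> < \<alpha>\<close>, those of a self-conjugate 7-core as \<open>\<alpha>\<close>, \<open>\<alpha> \<plusminus> \<alpha>\<close>, \<open>\<alpha> \<plusminus> \<beta>\<close>,
  \<open>\<alpha> \<plusminus> \<gamma>\<close>, and both size conditions read \<open>\<alpha>\<^sup>2 + \<beta>\<^sup>2 + \<gamma>\<^sup>2 = 56 n + 21\<close>. The map keeps \<open>\<alpha>\<close>, \<open>\<beta>\<close>, \<open>\<gamma>\<close>. Since the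
  sum of squares vanishes modulo 7, either all three numbers are divisible by 7, which forces
  \<open>n \<equiv> 4\<close>, or their squares are \<open>1, 2, 4\<close> in some order and the seven gaps are incongruent modulo 7.
  Similarly, modulo 8 the squares are \<open>0, 1, 4\<close>, so the four gaps are incongruent modulo 4. The
  7-core forgets exactly the sign of \<open>\<gamma> \<noteq> 0\<close>, hence the two preimages.
\<close>

section \<open>Partitions and structure numbers\<close>

definition is_partition :: "nat list \<Rightarrow> bool" where
  "is_partition p \<longleftrightarrow> sorted_wrt (\<ge>) p \<and> 0 \<notin> set p"

lemma is_partition_Cons:
  "is_partition (a # p) \<longleftrightarrow> 0 < a \<and> (\<forall>q \<in> set p. q \<le> a) \<and> is_partition p"
  by (auto simp: is_partition_def)

lemma structure_numbers_Nil [simp]: "structure_numbers [] = {}"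
  by (simp add: structure_numbers_def)

lemma structure_numbers_Cons:
  "structure_numbers (a # p) = insert (a + length p) (structure_numbers p)"
proof -
  have eq: "structure_numbers q = (\<lambda>i. q ! i + length q - Suc i) ` {..<length q}" for q
    by (auto simp: structure_numbers_def)
  show ?thesis
    by (simp add: eq lessThan_Suc_eq_insert_0 image_image)
qed

lemma structure_numbers_less:
  "x \<in> structure_numbers p \<Longrightarrow> (\<forall>q \<in> set p. q \<le> a) \<Longrightarrow> x < a + length p"
  by (induction p arbitrary: x) (fastforce simp: structure_numbers_Cons)+

lemma finite_structure_numbers [simp]: "finite (structure_numbers p)"
  by (induction p) (simp_all add: structure_numbers_Cons)

lemma card_structure_numbers:
  "is_partition p \<Longrightarrow> card (structure_numbers p) = length p"
  by (induction p)
    (auto simp: structure_numbers_Cons is_partition_Cons card_insert_if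
      dest: structure_numbers_less)

lemma zero_notin_structure_numbers:
  "is_partition p \<Longrightarrow> 0 \<notin> structure_numbers p"
  by (induction p) (auto simp: structure_numbers_Cons is_partition_Cons)

text \<open>The parts are shifted by 0, 1, ..., \<open>length p - 1\<close>. Both sides are doubled
  and taken in \<open>int\<close>, so nothing is divided or truncated.\<close>

lemma sum_structure_numbers:
  "is_partition p \<Longrightarrow>
    2 * int (\<Sum>(structure_numbers p)) = 2 * int (sum_list p) + int (length p) * (int (length p) - 1)"
proof (induction p)
  case (Cons a p)
  then have "a + length p \<notin> structure_numbers p"
    by (auto simp: is_partition_Cons dest: structure_numbers_less)
  with Cons show ?case
    by (simp add: structure_numbers_Cons is_partition_Cons algebra_simps)
qed simp

text \<open>The number of structure numbers gives the length, the largest one then gives the head,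
  and removing it leaves the tail.\<close>

lemma structure_numbers_inj:
  "\<lbrakk>is_partition p; is_partition q; structure_numbers p = structure_numbers q\<rbrakk> \<Longrightarrow> p = q"
proof (induction p arbitrary: q)
  case Nil
  then show ?case by (cases q) (auto simp: structure_numbers_Cons)
next
  case (Cons a p)
  then obtain b r where q: "q = b # r"
    by (cases q) (auto simp: structure_numbers_Cons)
  have len: "length p = length r"
    using card_structure_numbers[OF Cons.prems(1)] card_structure_numbers[OF Cons.prems(2)]
    by (simp add: Cons.prems(3) q)
  have below: "x < a + length p" if "x \<in> structure_numbers p" for x
    using structure_numbers_less[OF that] Cons.prems(1) by (simp add: is_partition_Cons)
  have below': "x < b + length r" if "x \<in> structure_numbers r" for x
    using structure_numbers_less[OF that] Cons.prems(2) by (simp add: is_partition_Cons q)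
  have ins: "insert (a + length p) (structure_numbers p) = insert (b + length r) (structure_numbers r)"
    using Cons.prems(3) by (simp add: structure_numbers_Cons q)
  have top: "a + length p = b + length r"
    using ins below below' by (metis insert_iff less_asym)
  have "a + length p \<notin> structure_numbers p" "b + length r \<notin> structure_numbers r"
    using below below' by blast+
  then have "structure_numbers p = structure_numbers r"
    using ins top by (metis insert_ident)
  then show ?case
    using Cons top len by (auto simp: is_partition_Cons q)
qed

text \<open>Elements are inserted in increasing order: a new maximum \<open>b\<close> becomes the
  leading part \<open>b - length p\<close>. Excluding 0 keeps the parts positive.\<close>

lemma structure_numbers_surj:
  assumes "finite X" "0 \<notin> X"
  shows "\<exists>p. is_partition p \<and> structure_numbers p = X"
  using assms
proof (induction X rule: finite_linorder_max_induct)
  case empty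
  show ?case by (intro exI[of _ "[]"]) (simp add: is_partition_def)
next
  case (insert b X)
  then obtain p where p: "is_partition p" "structure_numbers p = X" by auto
  have large: "q + length p \<le> b" if "q \<in> set p" for q
  proof (cases p)
    case (Cons a r)
    then have "a + length r < b"
      using insert.hyps p by (auto simp: structure_numbers_Cons)
    moreover have "q \<le> a" using that p Cons by (auto simp: is_partition_Cons)
    ultimately show ?thesis using Cons by simp
  qed (use that in simp)
  have pos: "0 < q" if "q \<in> set p" for q
    using p(1) that by (auto simp: is_partition_def intro: gr0I)
  have "length p < b"
  proof (cases p)
    case Nil
    then show ?thesis using insert.prems by (auto intro: gr0I)
  next
    case (Cons a r)
    then show ?thesis using large[of a] pos[of a] by simp
  qed
  moreover have "\<forall>q \<in> set p. q \<le> b - length p"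
    using large by fastforce
  ultimately have "is_partition ((b - length p) # p) \<and> structure_numbers ((b - length p) # p) = insert b X"
    using p by (simp add: is_partition_Cons structure_numbers_Cons)
  then show ?case by blast
qed

section \<open>Columns of the diagram and gaps between the structure numbers\<close>

definition column :: "nat list \<Rightarrow> nat \<Rightarrow> nat" where
  "column p j = length (filter (\<lambda>q. j < q) p)"

text \<open>In increasing order, the values of \<open>gap p\<close> are the natural numbers that are not structure numbers.\<close>

definition gap :: "nat list \<Rightarrow> nat \<Rightarrow> nat" where
  "gap p j = j + length p - column p j"

lemma column_le: "column p j \<le> length p"
  by (simp add: column_def)

lemma column_antimono: "j \<le> k \<Longrightarrow> column p k \<le> column p j"
  by (induction p) (auto simp: column_def)

lemma gap_strict_mono: "j < k \<Longrightarrow> gap p j < gap p k"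
  using column_antimono[of j k p] column_le[of p j] by (simp add: gap_def)

text \<open>As the parts decrease, the rows longer than \<open>j\<close> form an initial segment,
  and its length is \<open>column p j\<close>.\<close>

lemma less_nth_iff_less_column:
  "is_partition p \<Longrightarrow> i < length p \<Longrightarrow> j < p ! i \<longleftrightarrow> i < column p j"
proof (induction p arbitrary: i)
  case (Cons a p)
  show ?case
  proof (cases "j < a")
    case True
    with Cons show ?thesis
      by (cases i) (auto simp: column_def is_partition_Cons)
  next
    case False
    then have none: "\<forall>q \<in> set (a # p). \<not> j < q"
      using Cons.prems(1) by (fastforce simp: is_partition_Cons)
    then have "column (a # p) j = 0"
      unfolding column_def by (metis filter_False list.size(3))
    moreover have "\<not> j < (a # p) ! i"
      using none nth_mem[OF Cons.prems(2)] by blast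
    ultimately show ?thesis by simp
  qed
qed simp

text \<open>The structure number exceeds the gap by \<open>p ! i + column p j - (i + j + 1)\<close>.
  The conditions \<open>j < p ! i\<close> and \<open>i < column p j\<close> hold together, making
  this at least 1, or fail together, making it at most -1.\<close>

lemma gap_less_iff:
  assumes "is_partition p" "i < length p"
  shows "gap p j < p ! i + length p - Suc i \<longleftrightarrow> j < p ! i"
  using less_nth_iff_less_column[OF assms, of j] column_le[of p j] assms(2)
  by (auto simp: gap_def)

text \<open>Prepending a part \<open>a\<close> deletes \<open>gap p a = a + length p\<close>, the
  new structure number, from the sequence of gaps: entries before index \<open>a\<close> stay, later
  ones move down by one index.\<close>

lemma range_gap: "is_partition p \<Longrightarrow> range (gap p) = - structure_numbers p"
proof (induction p)
  case Nil
  have "gap [] = id" by (auto simp: gap_def column_def)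
  then show ?case by simp
next
  case (Cons a p)
  then have le: "\<forall>q \<in> set p. q \<le> a" and IH: "range (gap p) = - structure_numbers p"
    by (auto simp: is_partition_Cons)
  have c0: "column p j = 0" if "a \<le> j" for j
    using le that by (fastforce simp: column_def filter_empty_conv)
  have small: "gap (a # p) j = gap p j" if "j < a" for j
    using that column_le[of p j] by (simp add: gap_def column_def)
  have large: "gap (a # p) j = Suc (j + length p)" if "a \<le> j" for j
    using that c0[OF that] by (simp add: gap_def column_def)
  have large': "gap p j = j + length p" if "a \<le> j" for j
    using c0[OF that] by (simp add: gap_def)
  have less: "gap p j < a + length p" if "j < a" for j
    using gap_strict_mono[OF that, of p] large'[of a] by simp
  show ?case
  proof (intro set_eqI iffI)
    fix y assume "y \<in> range (gap (a # p))"
    then obtain j where j: "y = gap (a # p) j" by auto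
    show "y \<in> - structure_numbers (a # p)"
    proof (cases "j < a")
      case True
      then show ?thesis using IH small less j by (fastforce simp: structure_numbers_Cons)
    next
      case False
      then have "y = gap p (Suc j)" "y \<noteq> a + length p" using large large' j by auto
      then show ?thesis using IH by (auto simp: structure_numbers_Cons)
    qed
  next
    fix y assume "y \<in> - structure_numbers (a # p)"
    then have y: "y \<noteq> a + length p" "y \<in> range (gap p)"
      using IH by (auto simp: structure_numbers_Cons)
    then obtain j where j: "y = gap p j" by auto
    consider "j < a" | "j = a" | "a < j" by linarith
    then show "y \<in> range (gap (a # p))"
    proof cases
      case 1
      then show ?thesis using j small by (metis rangeI)
    next
      case 2
      then show ?thesis using j large' y by simp
    next
      case 3
      then have "y = gap (a # p) (j - 1)" using j large' large[of "j - 1"] by simp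
      then show ?thesis by blast
    qed
  qed
qed

section \<open>Hook lengths and conjugation\<close>

lemma length_conjugate: "length (conjugate p) = (if p = [] then 0 else p ! 0)"
  by (cases p) (simp_all add: conjugate_def)

lemma nth_conjugate: "p \<noteq> [] \<Longrightarrow> j < p ! 0 \<Longrightarrow> conjugate p ! j = column p j"
  by (cases p) (simp_all add: conjugate_def column_def)

lemma nth_le_hd: "is_partition p \<Longrightarrow> i < length p \<Longrightarrow> p ! i \<le> p ! 0"
  by (cases p) (auto simp: is_partition_Cons nth_Cons')

lemma hook_length_eq:
  assumes "is_partition p" "i < length p" "j < p ! i"
  shows "hook_length p i j = (p ! i + length p - Suc i) - gap p j"
proof -
  have "conjugate p ! j = column p j"
    using assms nth_le_hd[OF assms(1,2)] by (intro nth_conjugate) auto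
  then show ?thesis
    using assms less_nth_iff_less_column[OF assms(1,2), of j] column_le[of p j]
    by (simp add: hook_length_def gap_def)
qed

text \<open>The hook lengths are exactly the differences of a structure number and a smaller
  gap.\<close>

lemma is_core_iff:
  assumes "is_partition p"
  shows "is_core t p \<longleftrightarrow>
    (\<forall>x \<in> structure_numbers p. \<forall>y < x. y \<notin> structure_numbers p \<longrightarrow> \<not> t dvd x - y)"
    (is "_ \<longleftrightarrow> ?R")
proof
  assume core: "is_core t p"
  show ?R
  proof (intro ballI allI impI)
    fix x y assume x: "x \<in> structure_numbers p" and "y < x" and "y \<notin> structure_numbers p"
    then obtain j where j: "y = gap p j" using range_gap[OF assms] by blast
    from x obtain i where i: "i < length p" "x = p ! i + length p - Suc i"
      by (auto simp: structure_numbers_def)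
    then have "j < p ! i" using \<open>y < x\<close> gap_less_iff[OF assms] j by simp
    then show "\<not> t dvd x - y"
      using core i j hook_length_eq[OF assms] by (simp add: is_core_def)
  qed
next
  assume R: ?R
  show "is_core t p"
    unfolding is_core_def
  proof (intro allI impI)
    fix i j assume ij: "i < length p" "j < p ! i"
    have "gap p j \<notin> structure_numbers p" using range_gap[OF assms] by blast
    moreover have "p ! i + length p - Suc i \<in> structure_numbers p"
      using ij by (auto simp: structure_numbers_def)
    ultimately show "\<not> t dvd hook_length p i j"
      using R ij hook_length_eq[OF assms] gap_less_iff[OF assms] by metis
  qed
qed

lemma is_partition_conjugate:
  assumes "is_partition p"
  shows "is_partition (conjugate p)"
proof (cases "p = []")
  case True
  then show ?thesis by (simp add: conjugate_def is_partition_def)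
next
  case False
  have "conjugate p = map (column p) [0..<p ! 0]"
    using False by (intro nth_equalityI) (simp_all add: length_conjugate nth_conjugate)
  moreover have "0 < column p j" if "j < p ! 0" for j
    using less_nth_iff_less_column[OF assms, of 0 j] False that by simp
  ultimately show ?thesis
    by (fastforce simp: is_partition_def sorted_wrt_map column_antimono
        intro!: sorted_wrt_mono_rel[OF _ sorted_wrt_upt])
qed

text \<open>Transposing the diagram reverses its boundary path and exchanges structure numbers with
  gaps. \<open>M\<close> is the largest structure number, and the gaps below it belong to the first
  \<open>p ! 0\<close> columns.\<close>

lemma structure_numbers_conjugate:
  assumes "is_partition p" "p \<noteq> []"
  defines "M \<equiv> p ! 0 + length p - 1"
  shows "structure_numbers (conjugate p) = {M - y |y. y \<le> M \<and> y \<notin> structure_numbers p}"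
proof -
  have M: "M \<in> structure_numbers p"
    using assms by (auto simp: structure_numbers_def M_def)
  have le: "gap p j \<le> M \<longleftrightarrow> j < p ! 0" for j
  proof -
    have "gap p j \<noteq> M" using range_gap[OF assms(1)] M by blast
    moreover have "gap p j < M \<longleftrightarrow> j < p ! 0"
      using gap_less_iff[of p 0 j] assms by (simp add: M_def)
    ultimately show ?thesis by linarith
  qed
  have "conjugate p ! j + length (conjugate p) - Suc j = M - gap p j" if "j < p ! 0" for j
    using that assms column_le[of p j]
    by (simp add: length_conjugate nth_conjugate M_def gap_def)
  moreover have "length (conjugate p) = p ! 0"
    using assms(2) by (simp add: length_conjugate)
  ultimately have "structure_numbers (conjugate p) = {M - gap p j |j. j < p ! 0}"
    unfolding structure_numbers_def by (auto; metis)
  also have "\<dots> = {M - y |y. y \<le> M \<and> y \<in> range (gap p)}"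
    using le by fastforce
  finally show ?thesis using range_gap[OF assms(1)] by simp
qed

section \<open>Cores and their first gaps\<close>

lemma cores_iff: "p \<in> cores t m \<longleftrightarrow> is_partition p \<and> is_core t p \<and> sum_list p = m"
  by (auto simp: cores_def partition_of_def is_partition_def)

section \<open>Abaci whose beads are pushed to the bottom of each runner\<close>

text \<open>Runner \<open>c\<close> carries \<open>m c\<close> beads. Writing the set as the image
  of a dependent product lets cardinality and sum split by runners.\<close>

definition beads :: "nat \<Rightarrow> (nat \<Rightarrow> nat) \<Rightarrow> nat set" where
  "beads t m = (\<lambda>(c, k). c + t * k) ` (SIGMA c:{..<t}. {..<m c})"

lemma mem_beads_iff: "0 < t \<Longrightarrow> x \<in> beads t m \<longleftrightarrow> x div t < m (x mod t)"
  by (force simp: beads_def image_iff intro: bexI[of _ "(x mod t, x div t)"])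

lemma finite_beads [simp]: "finite (beads t m)"
  by (simp add: beads_def)

lemma inj_on_beads: "inj_on (\<lambda>(c, k). c + t * k) (SIGMA c:{..<t::nat}. {..<m c})"
proof (rule inj_onI, clarsimp)
  fix c k d l :: nat
  assume "c < t" "d < t" and eq: "c + t * k = d + t * l"
  then have "c = d" by (metis mod_less mod_mult_self2)
  then show "c = d \<and> k = l" using eq \<open>c < t\<close> by simp
qed

lemma card_beads: "card (beads t m) = (\<Sum>c<t. m c)"
  by (simp add: beads_def card_image[OF inj_on_beads])

lemma sum_beads:
  "2 * int (\<Sum>(beads t m)) = (\<Sum>c<t. 2 * int c * int (m c) + int t * (int (m c) * (int (m c) - 1)))"
proof -
  have inner: "2 * (\<Sum>k<n. int (c + t * k)) = 2 * int c * int n + int t * (int n * (int n - 1))"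
    for c n
    by (induction n) (simp_all add: algebra_simps)
  have "\<Sum>(beads t m) = (\<Sum>(c, k)\<in>(SIGMA c:{..<t}. {..<m c}). c + t * k)"
    unfolding beads_def by (subst sum.reindex[OF inj_on_beads]) (simp add: case_prod_beta')
  also have "\<dots> = (\<Sum>c<t. \<Sum>k<m c. c + t * k)"
    by (subst sum.Sigma) auto
  finally show ?thesis
    by (simp only: of_nat_sum sum_distrib_left inner[symmetric])
qed

lemma is_core_if_beads:
  assumes "is_partition p" "0 < t" "structure_numbers p = beads t m"
  shows "is_core t p"
  unfolding is_core_iff[OF assms(1)]
proof (intro ballI allI impI notI)
  fix x y
  assume x: "x \<in> structure_numbers p" and "y < x" and y: "y \<notin> structure_numbers p"
    and "t dvd x - y"
  then have "x mod t = y mod t" by (metis less_imp_le_nat mod_eq_dvd_iff_nat)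
  moreover have "y div t \<le> x div t" using \<open>y < x\<close> by (simp add: div_le_mono)
  ultimately show False using x y assms by (simp add: mem_beads_iff)
qed

lemma abacus_if_beads:
  assumes "0 < t" "structure_numbers p = beads t m" "c < t"
  shows "abacus t p ! c = m c"
proof -
  have "{x \<in> structure_numbers p. x mod t = c} = (\<lambda>k. c + t * k) ` {..<m c}"
    using assms by (auto simp: mem_beads_iff image_iff 
        intro!: bexI[of _ "x div t" for x] mod_mult_div_eq[symmetric])
  moreover have "inj_on (\<lambda>k. c + t * k) {..<m c}"
    using assms(1) by (auto simp: inj_on_def)
  ultimately have "card {x \<in> structure_numbers p. x mod t = c} = m c"
    by (metis card_image card_lessThan)
  then show ?thesis
    using assms(3) by (simp add: abacus_def)
qed

lemma down_closed_eq_lessThan: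
  fixes A :: "nat set"
  assumes "finite A" and down: "\<And>k l. k \<in> A \<Longrightarrow> l \<le> k \<Longrightarrow> l \<in> A"
  shows "\<exists>n. A = {..<n}"
proof (cases "A = {}")
  case False
  have "A = {..Max A}"
  proof (intro subset_antisym subsetI)
    show "k \<in> A" if "k \<in> {..Max A}" for k
      using that by (intro down[OF Max_in[OF assms(1) False]]) simp
  qed (simp add: assms(1))
  then show ?thesis by (metis lessThan_Suc_atMost)
qed auto

text \<open>A bead above a gap on the same runner would give a hook length divisible by
  \<open>t\<close>. Hence every runner is closed downwards and, being finite, an initial
  segment.\<close>

lemma structure_numbers_core:
  assumes "is_partition p" "is_core t p" "0 < t"
  shows "structure_numbers p = beads t (\<lambda>c. abacus t p ! c)"
proof -
  let ?X = "structure_numbers p"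
  have "\<exists>n. {k. c + t * k \<in> ?X} = {..<n}" for c
  proof (rule down_closed_eq_lessThan)
    have "inj (\<lambda>k. c + t * k)" using assms(3) by (auto simp: inj_on_def)
    then show "finite {k. c + t * k \<in> ?X}"
      using finite_vimageI[of ?X "\<lambda>k. c + t * k"] by (simp add: vimage_def)
    fix k l assume k: "k \<in> {k. c + t * k \<in> ?X}" and "l \<le> k"
    have "t dvd (c + t * k) - (c + t * l)"
      by (metis diff_add_inverse diff_cancel2 diff_mult_distrib2 add.commute dvd_triv_left)
    moreover have "c + t * l < c + t * k \<or> l = k"
      using \<open>l \<le> k\<close> assms(3) by auto
    ultimately show "l \<in> {k. c + t * k \<in> ?X}"
      using k assms(2) is_core_iff[OF assms(1)] by blast
  qed
  then obtain m where m: "{k. c + t * k \<in> ?X} = {..<m c}" for c by metis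
  have "x \<in> ?X \<longleftrightarrow> x \<in> beads t m" for x
    using m[of "x mod t"] mem_beads_iff[OF assms(3), of x m]
    by (auto simp: set_eq_iff mod_mult_div_eq dest!: spec[of _ "x div t"])
  then have X: "?X = beads t m" by blast
  then show ?thesis
    using abacus_if_beads[OF assms(3) X] assms(3) by (auto simp: mem_beads_iff)
qed

section \<open>First gaps as coordinates of a core\<close>

text \<open>For a core, the least natural number in the residue class of \<open>c\<close> that is not a structure number.\<close>

definition first_gap :: "nat \<Rightarrow> nat list \<Rightarrow> nat \<Rightarrow> int" where
  "first_gap t p c = int (t * abacus t p ! c + c)"

definition first_gaps :: "nat \<Rightarrow> nat list \<Rightarrow> int set" where
  "first_gaps t p = first_gap t p ` {..<t}"

lemma first_gap_mod: "c < t \<Longrightarrow> first_gap t p c mod int t = int c"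
  by (simp add: first_gap_def flip: of_nat_mod)

lemma first_gap_nonneg: "0 \<le> first_gap t p c"
  by (simp add: first_gap_def)

lemma inj_on_first_gap: "inj_on (first_gap t p) {..<t}"
  by (rule inj_onI) (metis first_gap_mod lessThan_iff of_nat_eq_iff)

lemma finite_first_gaps [simp]: "finite (first_gaps t p)"
  by (simp add: first_gaps_def)

lemma card_first_gaps: "card (first_gaps t p) = t"
  by (simp add: first_gaps_def card_image inj_on_first_gap)

lemma inj_on_mod_first_gaps: "inj_on (\<lambda>g. g mod int t) (first_gaps t p)"
  by (auto simp: inj_on_def first_gaps_def first_gap_mod)

lemma abacus_zero:
  assumes "p \<in> cores t m" "0 < t"
  shows "abacus t p ! 0 = 0"
  using zero_notin_structure_numbers[of p] structure_numbers_core[of p t] assms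
  by (simp add: cores_iff mem_beads_iff)

lemma zero_in_first_gaps:
  assumes "p \<in> cores t m" "0 < t"
  shows "0 \<in> first_gaps t p"
  using abacus_zero[OF assms] assms(2)
  by (force simp: first_gaps_def first_gap_def intro: image_eqI[of _ _ 0])

text \<open>Each first gap carries its runner as residue modulo \<open>t\<close>, so the unordered
  set already determines the abacus.\<close>

lemma first_gaps_inj:
  assumes "p \<in> cores t m" "q \<in> cores t n" "0 < t" "first_gaps t p = first_gaps t q"
  shows "p = q"
proof -
  have "abacus t p ! c = abacus t q ! c" if "c < t" for c
  proof -
    have "first_gap t p c \<in> first_gaps t q"
      using that assms(4) by (auto simp: first_gaps_def)
    then obtain d where d: "d < t" "first_gap t p c = first_gap t q d"
      by (auto simp: first_gaps_def)
    then have "c = d" using that by (metis first_gap_mod of_nat_eq_iff)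
    then show ?thesis using d assms(3) by (simp add: first_gap_def del: of_nat_add of_nat_mult)
  qed
  then have "beads t (\<lambda>c. abacus t p ! c) = beads t (\<lambda>c. abacus t q ! c)"
    by (auto simp: mem_beads_iff assms(3))
  then show ?thesis
    using assms structure_numbers_core structure_numbers_inj by (metis cores_iff)
qed

lemma core_exists:
  assumes "m 0 = 0" "0 < t"
  shows "\<exists>p. p \<in> cores t (sum_list p) \<and> (\<forall>c<t. abacus t p ! c = m c)"
proof -
  have "0 \<notin> beads t m" using assms by (simp add: mem_beads_iff)
  then obtain p where "is_partition p" "structure_numbers p = beads t m"
    using structure_numbers_surj by (metis finite_beads)
  then show ?thesis
    using is_core_if_beads abacus_if_beads assms(2) by (auto simp: cores_iff)
qed

text \<open>The element of \<open>G\<close> in each residue class, divided by \<open>t\<close>,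
  prescribes the bead count of that runner. \<open>0 \<in> G\<close> is the normalisation that
  runner 0 is empty.\<close>

lemma core_with_first_gaps_exists:
  fixes G :: "int set"
  assumes "card G = t" "0 < t" "inj_on (\<lambda>g. g mod int t) G" "0 \<in> G" "\<forall>g \<in> G. 0 \<le> g"
  shows "\<exists>p. p \<in> cores t (sum_list p) \<and> first_gaps t p = G"
proof -
  let ?r = "\<lambda>g. g mod int t"
  have fin: "finite G" using assms(1,2) card_gt_0_iff by blast
  have "?r ` G \<subseteq> {0..<int t}" using assms(2) by auto
  then have img: "?r ` G = {0..<int t}"
    using assms(1,3) by (intro card_subset_eq) (auto simp: card_image)
  define f where "f c = inv_into G ?r (int c)" for c
  have f: "f c \<in> G" "f c mod int t = int c" if "c < t" for c
    using that img by (auto simp: f_def inv_into_into f_inv_into_f[of _ ?r])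
  have f_G: "f ` {..<t} = G"
  proof (rule card_subset_eq[OF fin])
    show "f ` {..<t} \<subseteq> G" using f by auto
    have "inj_on f {..<t}" using f(2) by (metis inj_onI lessThan_iff of_nat_eq_iff)
    then show "card (f ` {..<t}) = card G" by (simp add: card_image assms(1))
  qed
  have "f 0 = 0"
    using f[of 0] assms(2-4) by (metis inj_onD mod_0 of_nat_0)
  then obtain p where p: "p \<in> cores t (sum_list p)" "\<forall>c<t. abacus t p ! c = nat (f c div int t)"
    using core_exists[of "\<lambda>c. nat (f c div int t)" t] assms(2) by auto
  have "first_gap t p c = f c" if "c < t" for c
  proof -
    have "0 \<le> f c div int t" using f(1)[OF that] assms(2,5) by (simp add: pos_imp_zdiv_nonneg_iff)
    then show ?thesis
      using p(2) that f(2)[OF that] by (simp add: first_gap_def) (metis mult_div_mod_eq)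
  qed
  then have "first_gaps t p = G" using f_G by (simp add: first_gaps_def)
  then show ?thesis using p(1) by blast
qed

section \<open>Size of a core\<close>

text \<open>Counting and adding the beads gives length and size; after multiplication by
  \<open>t\<close>, bead counts turn into first gaps. The two sums over \<open>c\<close> are the
  values at the empty partition, whose first gaps are \<open>0, ..., t - 1\<close>.\<close>

lemma core_size:
  assumes "p \<in> cores t m" "0 < t"
  defines "G \<equiv> first_gaps t p"
  shows "2 * (int t)\<^sup>2 * int m =
    int t * (\<Sum>g\<in>G. g\<^sup>2) - (\<Sum>g\<in>G. g)\<^sup>2 - int t * (\<Sum>c<t. (int c)\<^sup>2) + (\<Sum>c<t. int c)\<^sup>2"
proof -
  define a where "a c = int (abacus t p ! c)" for c
  define g where "g = first_gap t p"
  define C where "C = (\<Sum>c<t. int c)"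
  define D where "D = (\<Sum>c<t. (int c)\<^sup>2)"
  define S where "S = (\<Sum>c<t. g c)"
  define Q where "Q = (\<Sum>c<t. (g c)\<^sup>2)"
  have p: "is_partition p" "is_core t p" "sum_list p = m" using assms(1) by (auto simp: cores_iff)
  note X = structure_numbers_core[OF p(1,2) assms(2)]
  have SG: "(\<Sum>g\<in>G. g) = S" "(\<Sum>g\<in>G. g\<^sup>2) = Q"
    by (simp_all add: G_def first_gaps_def S_def Q_def g_def sum.reindex inj_on_first_gap)
  have ta: "int t * a c = g c - int c" for c
    by (simp add: g_def a_def first_gap_def)
  have len: "int (length p) = (\<Sum>c<t. a c)"
    using card_structure_numbers[OF p(1)] X by (simp add: card_beads a_def flip: of_nat_sum)
  have tlen: "int t * int (length p) = S - C"
    by (simp add: len sum_distrib_left ta S_def C_def sum_subtractf)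
  have "2 * int m + int (length p) * (int (length p) - 1) =
      (\<Sum>c<t. 2 * int c * a c + int t * (a c * (a c - 1)))"
    using sum_structure_numbers[OF p(1)] sum_beads[of t "\<lambda>c. abacus t p ! c"]
    by (simp add: X p(3) a_def)
  then have "int t * (2 * int m + int (length p) * (int (length p) - 1)) =
      (\<Sum>c<t. 2 * int c * (int t * a c) + (int t * a c) * (int t * a c - int t))"
    by (simp add: sum_distrib_left algebra_simps)
  also have "\<dots> = (\<Sum>c<t. (g c)\<^sup>2 - int t * g c - (int c)\<^sup>2 + int t * int c)"
    by (intro sum.cong) (simp_all add: ta power2_eq_square algebra_simps)
  also have "\<dots> = Q - int t * S - D + int t * C"
    by (simp add: Q_def S_def C_def D_def sum.distrib sum_subtractf sum_distrib_left)
  finally have main: "int t * (2 * int m + int (length p) * (int (length p) - 1)) =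
    Q - int t * S - D + int t * C" .
  have C: "2 * C = int t * (int t - 1)"
    unfolding C_def by (induction t) (simp_all add: algebra_simps)
  have "2 * (int t)\<^sup>2 * int m =
      int t * (int t * (2 * int m + int (length p) * (int (length p) - 1)))
      - (int t * int (length p)) * (int t * int (length p) - int t)"
    by (simp add: power2_eq_square algebra_simps)
  also have "\<dots> = int t * (Q - int t * S - D + int t * C) - (S - C) * (S - C - int t)"
    by (simp only: main tlen)
  \<comment> \<open>All remaining linear terms share the factor \<open>t * (t - 1) - 2 * C\<close>,
    which is zero.\<close>
  also have "\<dots> = int t * Q - S\<^sup>2 - int t * D + C\<^sup>2
      + (C - S) * (int t * (int t - 1) - 2 * C)"
    by (simp add: power2_eq_square algebra_simps)
  also have "\<dots> = int t * Q - S\<^sup>2 - int t * D + C\<^sup>2"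
    by (simp only: C) simp
  finally show ?thesis by (simp only: SG C_def D_def)
qed

section \<open>Self-conjugacy in terms of first gaps\<close>

text \<open>
  With all negative integers added to the structure numbers, conjugation becomes complementation
  followed by a reflection of the integers.
\<close>

definition extended_beads :: "nat list \<Rightarrow> int set" where
  "extended_beads p = {..<0} \<union> int ` structure_numbers p"

text \<open>The centre \<open>M\<close> can be left existential because it is forced: it is -1 for
  the empty partition and the largest structure number otherwise.\<close>

lemma conjugate_eq_iff:
  assumes "is_partition p"
  shows "conjugate p = p \<longleftrightarrow> (\<exists>M. \<forall>y. y \<in> extended_beads p \<longleftrightarrow> M - y \<notin> extended_beads p)"
proof (cases "p = []")
  case True
  have "\<forall>y. y \<in> extended_beads p \<longleftrightarrow> - 1 - y \<notin> extended_beads p"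
    by (auto simp: True extended_beads_def)
  moreover have "conjugate p = p" by (simp add: True conjugate_def)
  ultimately show ?thesis by blast
next
  case False
  let ?X = "structure_numbers p" and ?E = "extended_beads p"
  define N where "N = p ! 0 + length p - 1"
  have N: "N \<in> ?X" using False by (auto simp: N_def structure_numbers_def)
  have le: "x \<le> N" if "x \<in> ?X" for x
    using structure_numbers_less[OF that, of "p ! 0"] nth_le_hd[OF assms]
    by (fastforce simp: N_def in_set_conv_nth)
  have E: "int x \<in> ?E \<longleftrightarrow> x \<in> ?X" for x by (auto simp: extended_beads_def)
  have neg: "y \<in> ?E" if "y < 0" for y using that by (simp add: extended_beads_def)
  have big: "y \<notin> ?E" if "int N < y" for y using that le by (fastforce simp: extended_beads_def)
  have conj_mem: "x \<in> structure_numbers (conjugate p) \<longleftrightarrow> x \<le> N \<and> N - x \<notin> ?X" for x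
  proof -
    have "structure_numbers (conjugate p) = {N - y |y. y \<le> N \<and> y \<notin> ?X}"
      unfolding N_def by (rule structure_numbers_conjugate[OF assms False])
    then show ?thesis by (auto intro!: exI[of _ "N - x"])
  qed
  show ?thesis
  proof
    assume conj: "conjugate p = p"
    have "y \<in> ?E \<longleftrightarrow> int N - y \<notin> ?E" for y
    proof -
      consider "y < 0" | "int N < y" | x where "y = int x" "x \<le> N"
        by (metis int_nat_eq linorder_not_le nat_le_iff)
      then show ?thesis
      proof cases
        case 3
        then show ?thesis using conj_mem[of x] conj E by (simp flip: of_nat_diff)
      qed (use neg big in auto)
    qed
    then show "\<exists>M. \<forall>y. y \<in> ?E \<longleftrightarrow> M - y \<notin> ?E" by blast
  next
    assume "\<exists>M. \<forall>y. y \<in> ?E \<longleftrightarrow> M - y \<notin> ?E"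
    then obtain M where M: "y \<in> ?E \<longleftrightarrow> M - y \<notin> ?E" for y by blast
    \<comment> \<open>The choice \<open>y = M\<close> compares \<open>M\<close> with 0, which is
      never a bead.\<close>
    have "M \<in> ?E"
      using M[of M] E[of 0] zero_notin_structure_numbers[OF assms] by simp
    \<comment> \<open>A smaller \<open>M\<close> would make both \<open>N\<close> and the negative
      number \<open>M - N\<close> beads.\<close>
    moreover have "\<not> M < int N"
      using M[of "int N"] E N neg[of "M - int N"] by auto
    ultimately have "M = int N" using big by force
    then have "x \<in> structure_numbers (conjugate p) \<longleftrightarrow> x \<in> ?X" for x
      using conj_mem[of x] M[of "int x"] E le by (auto simp flip: of_nat_diff)
    then show "conjugate p = p"
      using structure_numbers_inj[OF is_partition_conjugate[OF assms] assms] by blast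
  qed
qed

text \<open>The beads of a runner are the positions below its first gap; negative integers are
  covered because first gaps are nonnegative.\<close>

lemma extended_beads_core:
  assumes "p \<in> cores t m" "0 < t"
  shows "y \<in> extended_beads p \<longleftrightarrow> (\<exists>g \<in> first_gaps t p. y < g \<and> y mod int t = g mod int t)"
    (is "_ \<longleftrightarrow> ?R")
proof -
  let ?c = "nat (y mod int t)"
  have c: "?c < t" using assms(2) by (simp add: nat_less_iff)
  have "?R \<longleftrightarrow> y < first_gap t p ?c"
  proof
    assume ?R
    then obtain d where "d < t" "y < first_gap t p d" "y mod int t = first_gap t p d mod int t"
      by (auto simp: first_gaps_def)
    then show "y < first_gap t p ?c" by (simp add: first_gap_mod)
  next
    assume "y < first_gap t p ?c"
    then show ?R using c assms(2) by (auto simp: first_gaps_def first_gap_mod)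
  qed
  also have "\<dots> \<longleftrightarrow> y \<in> extended_beads p"
  proof (cases "y < 0")
    case True
    then show ?thesis using first_gap_nonneg[of t p ?c] by (simp add: extended_beads_def)
  next
    case False
    then obtain x where x: "y = int x" by (metis linorder_not_less nonneg_int_cases)
    have "x div t < a \<longleftrightarrow> x < t * a + x mod t" for a
    proof -
      have "x < t * a + x mod t \<longleftrightarrow> t * (x div t) < t * a"
        by (metis add_less_cancel_right mult_div_mod_eq)
      then show ?thesis using assms(2) by simp
    qed
    moreover have "?c = x mod t" by (simp add: x flip: of_nat_mod)
    ultimately have "y < first_gap t p ?c \<longleftrightarrow> x \<in> structure_numbers p"
      using structure_numbers_core[of p t] assms
      by (simp add: cores_iff mem_beads_iff first_gap_def x del: of_nat_add of_nat_mult)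
    then show ?thesis by (auto simp: extended_beads_def x)
  qed
  finally show ?thesis by blast
qed

text \<open>A reflection at \<open>M\<close> that exchanges beads and gaps takes the last bead
  \<open>g - t\<close> of a runner to a first gap \<open>M + t - g\<close>. Hence the first gaps are
  reflected with \<open>T = M + t\<close>.\<close>

lemma conjugate_eq_iff_first_gaps:
  assumes "p \<in> cores t m" "0 < t"
  shows "conjugate p = p \<longleftrightarrow> (\<exists>T. (\<lambda>g. T - g) ` first_gaps t p = first_gaps t p)"
proof -
  let ?G = "first_gaps t p" and ?E = "extended_beads p"
  note E = extended_beads_core[OF assms]
  have p: "is_partition p" using assms by (simp add: cores_iff)
  have uniq: "g = h" if "g \<in> ?G" "h \<in> ?G" "g mod int t = h mod int t" for g h
    using inj_onD[OF inj_on_mod_first_gaps that(3) that(1,2)] .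
  have cong_less: "y \<le> z - int t" if "y < z" "y mod int t = z mod int t" for y z
  proof -
    have "int t dvd z - y" using that(2) by (simp add: mod_eq_dvd_iff[symmetric])
    then show ?thesis using that(1) zdvd_imp_le[of "int t" "z - y"] by simp
  qed
  show ?thesis
    unfolding conjugate_eq_iff[OF p]
  proof
    assume "\<exists>M. \<forall>y. y \<in> ?E \<longleftrightarrow> M - y \<notin> ?E"
    then obtain M where M: "y \<in> ?E \<longleftrightarrow> M - y \<notin> ?E" for y by blast
    let ?T = "M + int t"
    have reflect: "?T - g \<in> ?G" if g: "g \<in> ?G" for g
    proof -
      have "g \<notin> ?E" using E uniq g by blast
      moreover have "g - int t \<in> ?E" using E g assms(2) by (auto simp: mod_diff_eq intro!: bexI[of _ g])
      \<comment> \<open>\<open>M - g\<close> and \<open>?T - g\<close> are consecutive positions of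
        one runner, a bead and then a gap, so the latter is a first gap.\<close>
      ultimately have "M - g \<in> ?E" "?T - g \<notin> ?E"
        using M[of g] M[of "g - int t"] by (auto simp: algebra_simps)
      then obtain h where h: "h \<in> ?G" "M - g < h" "(M - g) mod int t = h mod int t"
        using E by blast
      have cong: "(?T - g) mod int t = h mod int t"
        using h(3) by (metis add_diff_eq add.commute diff_add_eq mod_add_self2)
      have "\<not> ?T - g < h" using \<open>?T - g \<notin> ?E\<close> E h(1) cong by blast
      moreover have "\<not> h < ?T - g" using cong_less[of h "?T - g"] cong h(2) by auto
      ultimately show ?thesis using h(1) by (metis linorder_less_linear)
    qed
    have "(\<lambda>g. ?T - g) ` ?G = ?G"
    proof
      show "?G \<subseteq> (\<lambda>g. ?T - g) ` ?G"
        using reflect by (auto intro!: image_eqI[of _ _ "?T - g" for g])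
    qed (use reflect in auto)
    then show "\<exists>T. (\<lambda>g. T - g) ` ?G = ?G" by blast
  next
    assume "\<exists>T. (\<lambda>g. T - g) ` ?G = ?G"
    then obtain T where T: "(\<lambda>g. T - g) ` ?G = ?G" by blast
    have "y \<in> ?E \<longleftrightarrow> (T - int t) - y \<notin> ?E" for y
    proof -
      have "nat (y mod int t) < t" using assms(2) by (simp add: nat_less_iff)
      then obtain g where g: "g \<in> ?G" "y mod int t = g mod int t"
        using first_gap_mod[of "nat (y mod int t)" t p] assms(2) by (force simp: first_gaps_def)
      have Tg: "T - g \<in> ?G" using T g(1) by blast
      have cong: "(T - int t - y) mod int t = (T - g) mod int t"
      proof -
        have "(T - int t - y) - (T - g) = (g - y) - int t" by simp
        moreover have "int t dvd g - y" using g(2) by (metis mod_eq_dvd_iff)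
        ultimately show ?thesis by (metis dvd_diff dvd_refl mod_eq_dvd_iff)
      qed
      have "y \<in> ?E \<longleftrightarrow> y < g" using E g uniq by metis
      moreover have "T - int t - y \<in> ?E \<longleftrightarrow> T - int t - y < T - g" using E Tg cong uniq by metis
      moreover have "y < g \<longleftrightarrow> \<not> T - int t - y < T - g"
        using cong_less[of y g] g(2) assms(2) by auto
      ultimately show ?thesis by blast
    qed
    then show "\<exists>M. \<forall>y. y \<in> ?E \<longleftrightarrow> M - y \<notin> ?E" by blast
  qed
qed

section \<open>From 4-cores to self-conjugate 7-cores\<close>

text \<open>
  If \<open>x < y < z\<close> are the sorted nonzero first gaps of a 4-core, the parameters are
  \<open>\<alpha> = (y + z - x) / 2\<close>, \<open>\<beta> = (x + z - y) / 2\<close> and \<open>\<gamma> = (x + y - z) / 2\<close>. For a self-conjugate 7-core,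
  \<open>\<alpha>\<close> is the centre of symmetry of the first gaps.
\<close>

definition four_gaps :: "int \<Rightarrow> int \<Rightarrow> int \<Rightarrow> int list" where
  "four_gaps \<alpha> \<beta> \<gamma> = [0, \<beta> + \<gamma>, \<alpha> + \<gamma>, \<alpha> + \<beta>]"

definition seven_gaps :: "int \<Rightarrow> int \<Rightarrow> int \<Rightarrow> int list" where
  "seven_gaps \<alpha> \<beta> \<gamma> = [0, \<alpha> - \<beta>, \<alpha> - \<gamma>, \<alpha>, \<alpha> + \<gamma>, \<alpha> + \<beta>, 2 * \<alpha>]"

lemma sorted_four_gaps: "\<lbrakk>\<bar>\<gamma>\<bar> < \<beta>; \<beta> < \<alpha>\<rbrakk> \<Longrightarrow> sorted_wrt (<) (four_gaps \<alpha> \<beta> \<gamma>)"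
  by (auto simp: four_gaps_def)

lemma sorted_seven_gaps: "\<lbrakk>0 < \<gamma>; \<gamma> < \<beta>; \<beta> < \<alpha>\<rbrakk> \<Longrightarrow> sorted_wrt (<) (seven_gaps \<alpha> \<beta> \<gamma>)"
  by (auto simp: seven_gaps_def)

text \<open>The bounds on the parameters fix the order of the entries, so equal sets give equal
  lists.\<close>

lemma four_gaps_inj:
  assumes "\<bar>\<gamma>\<bar> < \<beta>" "\<beta> < \<alpha>" "\<bar>\<gamma>'\<bar> < \<beta>'" "\<beta>' < \<alpha>'"
    and "set (four_gaps \<alpha> \<beta> \<gamma>) = set (four_gaps \<alpha>' \<beta>' \<gamma>')"
  shows "\<alpha> = \<alpha>' \<and> \<beta> = \<beta>' \<and> \<gamma> = \<gamma>'"
proof -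
  have "four_gaps \<alpha> \<beta> \<gamma> = four_gaps \<alpha>' \<beta>' \<gamma>'"
    using assms by (intro strict_sorted_equal sorted_four_gaps) auto
  then show ?thesis by (auto simp: four_gaps_def)
qed

lemma seven_gaps_inj:
  assumes "0 < \<gamma>" "\<gamma> < \<beta>" "\<beta> < \<alpha>" "0 < \<gamma>'" "\<gamma>' < \<beta>'" "\<beta>' < \<alpha>'"
    and "set (seven_gaps \<alpha> \<beta> \<gamma>) = set (seven_gaps \<alpha>' \<beta>' \<gamma>')"
  shows "\<alpha> = \<alpha>' \<and> \<beta> = \<beta>' \<and> \<gamma> = \<gamma>'"
proof -
  have "seven_gaps \<alpha> \<beta> \<gamma> = seven_gaps \<alpha>' \<beta>' \<gamma>'"
    using assms by (intro strict_sorted_equal sorted_seven_gaps) auto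
  then show ?thesis by (auto simp: seven_gaps_def)
qed

text \<open>\<open>\<alpha> - \<gamma>\<close> and \<open>\<alpha> + \<gamma>\<close> trade places;
  this ambiguity produces the two preimages.\<close>

lemma set_seven_gaps_uminus: "set (seven_gaps \<alpha> \<beta> (- \<gamma>)) = set (seven_gaps \<alpha> \<beta> \<gamma>)"
  by (auto simp: seven_gaps_def)

text \<open>The gaps add up to \<open>2 * (\<alpha> + \<beta> + \<gamma>)\<close>, and the mixed
  products cancel between the two quadratic terms of \<open>core_size\<close>, leaving 4 times the
  sum of squares.\<close>

lemma core4_size:
  assumes "p \<in> cores 4 m" "first_gaps 4 p = set (four_gaps \<alpha> \<beta> \<gamma>)" "distinct (four_gaps \<alpha> \<beta> \<gamma>)"
  shows "\<alpha>\<^sup>2 + \<beta>\<^sup>2 + \<gamma>\<^sup>2 = 8 * int m + 5"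
proof -
  have "2 * 4\<^sup>2 * int m = 4 * sum_list (map (\<lambda>g. g\<^sup>2) (four_gaps \<alpha> \<beta> \<gamma>))
      - (sum_list (map (\<lambda>g. g) (four_gaps \<alpha> \<beta> \<gamma>)))\<^sup>2 - 4 * (\<Sum>c<4. (int c)\<^sup>2) + (\<Sum>c<4. int c)\<^sup>2"
    using core_size[OF assms(1)] by (simp add: assms(2) sum.distinct_set_conv_list[OF assms(3)])
  then show ?thesis
    by (simp add: four_gaps_def eval_nat_numeral lessThan_Suc algebra_simps)
qed

text \<open>By symmetry the gaps add up to \<open>7 * \<alpha>\<close>, and the quadratic terms
  leave 14 times the sum of squares.\<close>

lemma core7_size:
  assumes "p \<in> cores 7 m" "first_gaps 7 p = set (seven_gaps \<alpha> \<beta> \<gamma>)" "distinct (seven_gaps \<alpha> \<beta> \<gamma>)"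
  shows "\<alpha>\<^sup>2 + \<beta>\<^sup>2 + \<gamma>\<^sup>2 = 7 * int m + 14"
proof -
  have "2 * 7\<^sup>2 * int m = 7 * sum_list (map (\<lambda>g. g\<^sup>2) (seven_gaps \<alpha> \<beta> \<gamma>))
      - (sum_list (map (\<lambda>g. g) (seven_gaps \<alpha> \<beta> \<gamma>)))\<^sup>2 - 7 * (\<Sum>c<7. (int c)\<^sup>2) + (\<Sum>c<7. int c)\<^sup>2"
    using core_size[OF assms(1)] by (simp add: assms(2) sum.distinct_set_conv_list[OF assms(3)])
  then show ?thesis
    by (simp add: seven_gaps_def eval_nat_numeral lessThan_Suc algebra_simps)
qed

lemma core4_parameters:
  assumes "p \<in> cores 4 m"
  shows "\<exists>\<alpha> \<beta> \<gamma>. \<bar>\<gamma>\<bar> < \<beta> \<and> \<beta> < \<alpha> \<and> first_gaps 4 p = set (four_gaps \<alpha> \<beta> \<gamma>) \<and>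
    C_elems p = map of_int [\<alpha> + \<gamma>, \<alpha> + \<beta>, \<alpha> - \<beta>, \<alpha> - \<gamma>, \<alpha>, 2 * \<alpha>]"
proof -
  let ?bs = "[b_val p 1, b_val p 2, b_val p 3]"
  have b: "b_val p j = 4 * (abacus 4 p ! j) + j" for j by (simp add: b_val_def)
  define s where "s = sort ?bs"
  have "length s = 3" unfolding s_def by (subst length_sort) simp
  then obtain x y z where xyz: "s = [x, y, z]"
    by (auto simp: length_Suc_conv numeral_3_eq_3)
  have "b_val p 1 mod 4 = 1" "b_val p 2 mod 4 = 2" "b_val p 3 mod 4 = 3"
    unfolding b by presburger+
  then have "distinct ?bs" by auto
  then have "distinct s" unfolding s_def by (simp only: distinct_sort)
  moreover have "sorted s" unfolding s_def by (rule sorted_sort)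
  ultimately have less: "x < y" "y < z" by (auto simp: xyz)
  have "set s = set ?bs" unfolding s_def by (rule set_sort)
  then have set_eq: "{x, y, z} = {b_val p 1, b_val p 2, b_val p 3}"
    by (simp only: xyz list.set)
  then have "x \<in> {b_val p 1, b_val p 2, b_val p 3}" by blast
  then have "0 < x" by (auto simp: b)
  have "x + y + z = sum_list s" by (simp add: xyz)
  also have "\<dots> = sum_list ?bs" unfolding s_def by (metis mset_sort sum_mset_sum_list)
  \<comment> \<open>The residues 1, 2, 3 add up to an even number, so the half-sum \<open>k\<close>
    is an integer and so is \<open>(y + z - x) / 2 = k - x\<close>.\<close>
  finally have "x + y + z = 2 * (2 * (abacus 4 p ! 1 + abacus 4 p ! 2 + abacus 4 p ! 3) + 3)"
    by (simp add: b)
  then obtain k where k: "x + y + z = 2 * k" by blast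
  define \<alpha> \<beta> \<gamma> where "\<alpha> = int k - int x" and "\<beta> = int k - int y" and "\<gamma> = int k - int z"
  have xs: "int x = \<beta> + \<gamma>" "int y = \<alpha> + \<gamma>" "int z = \<alpha> + \<beta>"
    using k by (auto simp: \<alpha>_def \<beta>_def \<gamma>_def)
  have "first_gaps 4 p = {int 0, int (b_val p 1), int (b_val p 2), int (b_val p 3)}"
    using abacus_zero[OF assms]
    by (auto simp: first_gaps_def first_gap_def b eval_nat_numeral lessThan_Suc)
  also have "\<dots> = insert 0 (int ` {b_val p 1, b_val p 2, b_val p 3})" by simp
  also have "\<dots> = set (four_gaps \<alpha> \<beta> \<gamma>)"
    by (simp only: set_eq[symmetric]) (simp add: xs four_gaps_def)
  finally have "first_gaps 4 p = set (four_gaps \<alpha> \<beta> \<gamma>)" .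
  moreover have "C_elems p = map of_int [int y, int z, int y - int x, int z - int x, \<alpha>, 2 * \<alpha>]"
  proof -
    have "2 * \<alpha> = int y + int z - int x" using xs by simp
    then have "(of_int (2 * \<alpha>) :: rat) = of_int (int y + int z - int x)" by (simp only:)
    then have "2 * (of_int \<alpha> :: rat) = of_nat y + of_nat z - of_nat x" by simp
    then show ?thesis
      unfolding C_elems_def s_def[symmetric] xyz Let_def by simp
  qed
  \<comment> \<open>The bounds restate \<open>0 < x\<close>, \<open>y < z\<close> and
    \<open>x < y\<close>, since \<open>\<beta> + \<gamma> = x\<close>,
    \<open>\<beta> - \<gamma> = z - y\<close> and \<open>\<alpha> - \<beta> = y - x\<close>.\<close>
  moreover have "\<bar>\<gamma>\<bar> < \<beta>" "\<beta> < \<alpha>" using xs less \<open>0 < x\<close> by auto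
  ultimately show ?thesis using xs by (intro exI[of _ \<alpha>] exI[of _ \<beta>] exI[of _ \<gamma>]) auto
qed

section \<open>Residues forced by the sum of squares\<close>

text \<open>Only the residues of the three parameters matter, and all 343 triples are checked by
  evaluation. The zero triple is left over and excluded by the condition on
  \<open>n\<close>.\<close>

lemma residues_mod_7:
  fixes n :: nat
  assumes sq: "\<alpha>\<^sup>2 + \<beta>\<^sup>2 + \<gamma>\<^sup>2 = 56 * int n + 21" and n: "\<not> [n = 4] (mod 7)"
  shows "distinct (map (\<lambda>g. g mod 7) [0, \<alpha> + \<gamma>, \<alpha> + \<beta>, \<alpha> - \<beta>, \<alpha> - \<gamma>, \<alpha>, 2 * \<alpha>])"
proof -
  let ?a = "\<alpha> mod 7" and ?b = "\<beta> mod 7" and ?c = "\<gamma> mod 7"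
  have mem: "x mod 7 \<in> set [0..6]" for x :: int
    unfolding set_upto using pos_mod_bound[of 7 x] by auto
  have all: "\<forall>a \<in> set [0..6]. \<forall>b \<in> set [0..6]. \<forall>c \<in> set [0..6]. (a * a + b * b + c * c) mod 7 = 0 \<longrightarrow>
      a = 0 \<and> b = 0 \<and> c = 0 \<or>
      distinct (map (\<lambda>g. g mod (7::int)) [0, a + c, a + b, a - b, a - c, a, 2 * a])"
    by code_simp
  have "[?a * ?a + ?b * ?b + ?c * ?c = \<alpha>\<^sup>2 + \<beta>\<^sup>2 + \<gamma>\<^sup>2] (mod 7)"
    unfolding power2_eq_square by (intro cong_add cong_mult) (simp_all add: cong_def)
  then have "(?a * ?a + ?b * ?b + ?c * ?c) mod 7 = (\<alpha>\<^sup>2 + \<beta>\<^sup>2 + \<gamma>\<^sup>2) mod 7"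
    by (simp add: cong_def)
  also have "\<dots> = 0"
    unfolding sq by presburger
  finally have "?a = 0 \<and> ?b = 0 \<and> ?c = 0 \<or>
    distinct (map (\<lambda>g. g mod (7::int)) [0, ?a + ?c, ?a + ?b, ?a - ?b, ?a - ?c, ?a, 2 * ?a])"
    by (rule all[rule_format, OF mem[of \<alpha>] mem[of \<beta>] mem[of \<gamma>]])
  then show ?thesis
  proof
    assume "?a = 0 \<and> ?b = 0 \<and> ?c = 0"
    then obtain a b c where "\<alpha> = 7 * a" "\<beta> = 7 * b" "\<gamma> = 7 * c"
      by (auto elim!: dvdE simp: mod_eq_0_iff_dvd)
    \<comment> \<open>A factor 7 is cancelled from
      \<open>49 * (a\<^sup>2 + b\<^sup>2 + c\<^sup>2) = 56 * n + 21\<close>; modulo 7 this leaves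
      \<open>n + 3 = 0\<close>.\<close>
    then have "7 * (a\<^sup>2 + b\<^sup>2 + c\<^sup>2) = 8 * int n + 3" using sq by (simp add: power2_eq_square)
    then have "n mod 7 = 4" by presburger
    then show ?thesis using n by (simp add: cong_def)
  next
    assume "distinct (map (\<lambda>g. g mod (7::int)) [0, ?a + ?c, ?a + ?b, ?a - ?b, ?a - ?c, ?a, 2 * ?a])"
    then show ?thesis by (simp add: mod_simps)
  qed
qed

text \<open>The check runs over residues modulo 8, where squares also separate 0 from 2 modulo 4:
  one parameter is odd, one is 2 and one is 0 modulo 4.\<close>

lemma residues_mod_4:
  assumes sq: "\<alpha>\<^sup>2 + \<beta>\<^sup>2 + \<gamma>\<^sup>2 = 8 * int m + 5"
  shows "distinct (map (\<lambda>g. g mod 4) (four_gaps \<alpha> \<beta> \<gamma>))"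
proof -
  let ?a = "\<alpha> mod 8" and ?b = "\<beta> mod 8" and ?c = "\<gamma> mod 8"
  have mem: "x mod 8 \<in> set [0..7]" for x :: int
    unfolding set_upto using pos_mod_bound[of 8 x] by auto
  have all: "\<forall>a \<in> set [0..7]. \<forall>b \<in> set [0..7]. \<forall>c \<in> set [0..7]. (a * a + b * b + c * c) mod 8 = 5 \<longrightarrow>
      distinct (map (\<lambda>g. g mod (4::int)) [0, b + c, a + c, a + b])"
    by code_simp
  have "[?a * ?a + ?b * ?b + ?c * ?c = \<alpha>\<^sup>2 + \<beta>\<^sup>2 + \<gamma>\<^sup>2] (mod 8)"
    unfolding power2_eq_square by (intro cong_add cong_mult) (simp_all add: cong_def)
  then have "(?a * ?a + ?b * ?b + ?c * ?c) mod 8 = (\<alpha>\<^sup>2 + \<beta>\<^sup>2 + \<gamma>\<^sup>2) mod 8"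
    by (simp add: cong_def)
  also have "\<dots> = 5"
    unfolding sq by presburger
  finally have "distinct (map (\<lambda>g. g mod (4::int)) [0, ?b + ?c, ?a + ?c, ?a + ?b])"
    by (rule all[rule_format, OF mem[of \<alpha>] mem[of \<beta>] mem[of \<gamma>]])
  moreover have "(x mod 8 + y mod 8) mod 4 = (x + y) mod 4" for x y :: int
  proof -
    have "z mod 8 mod 4 = z mod 4" for z :: int by (simp add: mod_mod_cancel)
    then show ?thesis by (metis mod_add_eq)
  qed
  ultimately show ?thesis by (simp add: four_gaps_def)
qed

section \<open>Evaluation of the map\<close>

text \<open>Zero and the six elements are the first gaps of a 7-core. Its first gap on runner
  \<open>i\<close> is \<open>c_elem p i\<close>, so the floor of the quotient is a bead count; this
  resolves both definite descriptions.\<close>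

lemma phi_eqI:
  fixes cs :: "int list"
  assumes C: "C_elems p = map of_int cs" and "length cs = 6" and "\<forall>c \<in> set cs. 0 \<le> c"
    and dist: "distinct (map (\<lambda>g. g mod 7) (0 # cs))"
  shows "phi p \<in> cores 7 (sum_list (phi p))" "map int (abacus 7 (phi p)) = phi_tuple p"
    "first_gaps 7 (phi p) = set (0 # cs)"
proof -
  let ?G = "set (0 # cs)"
  have inj: "inj_on (\<lambda>g. g mod 7) ?G" and "distinct (0 # cs)"
    using dist distinct_map by blast+
  then have "card ?G = 7"
    using assms(2) distinct_card by fastforce
  then obtain \<mu> where \<mu>: "\<mu> \<in> cores 7 (sum_list \<mu>)" "first_gaps 7 \<mu> = ?G"
    using core_with_first_gaps_exists[of ?G 7] inj assms(3) by auto
  have c_elem: "c_elem p i = of_int (first_gap 7 \<mu> i)" if "1 \<le> i" "i < 7" for i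
  proof -
    let ?g = "first_gap 7 \<mu> i"
    have g: "?g \<in> ?G" using that \<mu>(2) by (auto simp: first_gaps_def)
    have gi: "?g mod 7 = int i" using first_gap_mod[of i 7 \<mu>] that by simp
    then have "?g \<noteq> 0" using that by auto
    then have "?g \<in> set cs" using g by simp
    show ?thesis
      unfolding c_elem_def
    proof (rule the_equality)
      show "of_int ?g \<in> set (C_elems p) \<and> [\<lfloor>of_int ?g :: rat\<rfloor> = int i] (mod 7)"
        using \<open>?g \<in> set cs\<close> gi that by (auto simp: C cong_def)
      fix c assume c: "c \<in> set (C_elems p) \<and> [\<lfloor>c\<rfloor> = int i] (mod 7)"
      then obtain d where d: "d \<in> set cs" "c = of_int d" by (auto simp: C)
      then have "d mod 7 = ?g mod 7" using c gi that by (simp add: cong_def)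
      then show "c = of_int ?g" using inj_onD[OF inj _ _ g, of d] d by simp
    qed
  qed
  have tuple: "map int (abacus 7 \<mu>) = phi_tuple p"
  proof (rule nth_equalityI)
    show "length (map int (abacus 7 \<mu>)) = length (phi_tuple p)"
      by (simp add: abacus_def phi_tuple_def)
    fix i assume "i < length (map int (abacus 7 \<mu>))"
    then have i: "i < 7" by (simp add: abacus_def)
    show "map int (abacus 7 \<mu>) ! i = phi_tuple p ! i"
    proof (cases "i = 0")
      case True
      then show ?thesis using abacus_zero[OF \<mu>(1)] by (simp add: abacus_def phi_tuple_def)
    next
      case False
      have "phi_tuple p ! i = \<lfloor>c_elem p i / 7\<rfloor>"
        using i False nth_upt[of 1 "i - 1" 7] by (simp add: phi_tuple_def nth_Cons')
      also have "\<dots> = \<lfloor>(of_int (first_gap 7 \<mu> i) :: rat) / of_int 7\<rfloor>"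
        using c_elem i False by simp
      also have "\<dots> = first_gap 7 \<mu> i div 7"
        by (rule floor_divide_of_int_eq)
      also have "\<dots> = int (abacus 7 \<mu> ! i)"
        using i by (simp add: first_gap_def)
      finally show ?thesis using i by (simp add: abacus_def)
    qed
  qed
  have "phi p = \<mu>"
    unfolding phi_def
  proof (rule the_equality)
    show "(\<exists>m. \<mu> \<in> cores 7 m) \<and> map int (abacus 7 \<mu>) = phi_tuple p"
      using \<mu>(1) tuple by blast
    fix \<nu> assume \<nu>: "(\<exists>m. \<nu> \<in> cores 7 m) \<and> map int (abacus 7 \<nu>) = phi_tuple p"
    then have "abacus 7 \<nu> = abacus 7 \<mu>"
      using tuple by (metis inj_map_eq_map inj_of_nat)
    then show "\<nu> = \<mu>"
      using \<nu> \<mu>(1) first_gaps_inj[of \<nu> 7 _ \<mu>] by (auto simp: first_gaps_def first_gap_def)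
  qed
  then show "phi p \<in> cores 7 (sum_list (phi p))" "map int (abacus 7 (phi p)) = phi_tuple p"
    "first_gaps 7 (phi p) = set (0 # cs)"
    using \<mu> tuple by auto
qed

lemma phi_parameters:
  assumes p: "p \<in> cores 4 (7 * n + 2)" and n: "\<not> [n = 4] (mod 7)"
  obtains \<alpha> \<beta> \<gamma> where "\<bar>\<gamma>\<bar> < \<beta>" "\<beta> < \<alpha>" "\<gamma> \<noteq> 0"
    "first_gaps 4 p = set (four_gaps \<alpha> \<beta> \<gamma>)"
    "first_gaps 7 (phi p) = set (seven_gaps \<alpha> \<beta> \<gamma>)"
    "C_elems p = map of_int [\<alpha> + \<gamma>, \<alpha> + \<beta>, \<alpha> - \<beta>, \<alpha> - \<gamma>, \<alpha>, 2 * \<alpha>]"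
    "distinct (map (\<lambda>g. g mod 7) [0, \<alpha> + \<gamma>, \<alpha> + \<beta>, \<alpha> - \<beta>, \<alpha> - \<gamma>, \<alpha>, 2 * \<alpha>])"
    "map int (abacus 7 (phi p)) = phi_tuple p"
    "phi p \<in> sc_cores 7 (8 * n + 1)"
proof -
  obtain \<alpha> \<beta> \<gamma> where par: "\<bar>\<gamma>\<bar> < \<beta>" "\<beta> < \<alpha>"
    and F: "first_gaps 4 p = set (four_gaps \<alpha> \<beta> \<gamma>)"
    and C: "C_elems p = map of_int [\<alpha> + \<gamma>, \<alpha> + \<beta>, \<alpha> - \<beta>, \<alpha> - \<gamma>, \<alpha>, 2 * \<alpha>]"
    using core4_parameters[OF p] by blast
  have sq: "\<alpha>\<^sup>2 + \<beta>\<^sup>2 + \<gamma>\<^sup>2 = 56 * int n + 21"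
    using core4_size[OF p F] sorted_four_gaps[OF par] by (simp add: strict_sorted_iff)
  note res = residues_mod_7[OF sq n]
  have nonneg: "\<forall>c \<in> set [\<alpha> + \<gamma>, \<alpha> + \<beta>, \<alpha> - \<beta>, \<alpha> - \<gamma>, \<alpha>, 2 * \<alpha>]. 0 \<le> c"
    using par by auto
  let ?cs = "[\<alpha> + \<gamma>, \<alpha> + \<beta>, \<alpha> - \<beta>, \<alpha> - \<gamma>, \<alpha>, 2 * \<alpha>]"
  have set_eq: "set (seven_gaps \<alpha> \<beta> \<gamma>) = set (0 # ?cs)"
    by (auto simp: seven_gaps_def)
  have G: "first_gaps 7 (phi p) = set (seven_gaps \<alpha> \<beta> \<gamma>)"
    unfolding set_eq by (rule phi_eqI(3)[OF C _ nonneg res]) simp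
  have "distinct (0 # ?cs)"
    using res distinct_map by blast
  \<comment> \<open>The two lists order the gaps differently, so distinctness is transferred through
    the cardinality of their common set.\<close>
  then have "card (set (seven_gaps \<alpha> \<beta> \<gamma>)) = length (0 # ?cs)"
    unfolding set_eq by (rule distinct_card)
  then have dist: "distinct (seven_gaps \<alpha> \<beta> \<gamma>)"
    by (intro card_distinct) (simp add: seven_gaps_def)
  have core: "phi p \<in> cores 7 (sum_list (phi p))"
    using phi_eqI(1)[OF C _ nonneg res] by simp
  have "7 * int (sum_list (phi p)) + 14 = 56 * int n + 21"
    using core7_size[OF core G dist] sq by simp
  then have "sum_list (phi p) = 8 * n + 1" by linarith
  moreover have "(\<lambda>g. 2 * \<alpha> - g) ` first_gaps 7 (phi p) = first_gaps 7 (phi p)"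
    unfolding G by (auto simp: seven_gaps_def)
  ultimately have "phi p \<in> sc_cores 7 (8 * n + 1)"
    using core conjugate_eq_iff_first_gaps[OF core] by (auto simp: sc_cores_def)
  \<comment> \<open>For \<open>\<gamma> = 0\<close> the entries \<open>\<alpha> - \<gamma>\<close>,
    \<open>\<alpha>\<close> and \<open>\<alpha> + \<gamma>\<close> would coincide.\<close>
  moreover have "\<gamma> \<noteq> 0" using dist by (auto simp: seven_gaps_def)
  moreover have "map int (abacus 7 (phi p)) = phi_tuple p"
    by (rule phi_eqI(2)[OF C _ nonneg res]) simp
  ultimately show ?thesis
    using that[OF par _ F G C res] by blast
qed

section \<open>Fibres of the map\<close>

text \<open>A reflection preserving the seven gaps reverses their sorted list and fixes the middle
  entry, which serves as \<alpha>. The smallest gap is 0, so the largest is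
  \<open>2 * \<alpha>\<close>.\<close>

lemma sc_core7_parameters:
  assumes "\<mu> \<in> sc_cores 7 m"
  obtains \<alpha> \<beta> \<gamma> where "0 < \<gamma>" "\<gamma> < \<beta>" "\<beta> < \<alpha>" "first_gaps 7 \<mu> = set (seven_gaps \<alpha> \<beta> \<gamma>)"
proof -
  let ?G = "first_gaps 7 \<mu>"
  have \<mu>: "\<mu> \<in> cores 7 m" "conjugate \<mu> = \<mu>" using assms by (auto simp: sc_cores_def)
  then obtain T where T: "(\<lambda>g. T - g) ` ?G = ?G"
    using conjugate_eq_iff_first_gaps[OF \<mu>(1)] by auto
  define gs where "gs = sorted_list_of_set ?G"
  have gs: "sorted_wrt (<) gs" "set gs = ?G" "length gs = 7"
    by (simp_all add: gs_def card_first_gaps)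
  have "sorted_wrt (<) (rev (map (\<lambda>g. T - g) gs))"
    using gs(1) by (simp add: sorted_wrt_rev sorted_wrt_map)
  then have reflect: "rev (map (\<lambda>g. T - g) gs) = gs"
    using gs T by (intro strict_sorted_equal) auto
  obtain g0 g1 g2 g3 g4 g5 g6 where g: "gs = [g0, g1, g2, g3, g4, g5, g6]"
    using gs(3) by (auto simp: length_Suc_conv eval_nat_numeral)
  have "0 \<in> set gs" using zero_in_first_gaps[OF \<mu>(1)] gs(2) by simp
  moreover have "g0 \<in> ?G" unfolding gs(2)[symmetric] g by simp
  then have "0 \<le> g0" by (auto simp: first_gaps_def first_gap_nonneg)
  ultimately have "g0 = 0" using gs(1) g by auto
  have "T - g6 = g0" "T - g5 = g1" "T - g4 = g2" "T - g3 = g3"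
    using reflect by (simp_all add: g)
  then have "gs = seven_gaps g3 (g3 - g1) (g3 - g2)"
    using \<open>g0 = 0\<close> by (simp add: g seven_gaps_def)
  then have "?G = set (seven_gaps g3 (g3 - g1) (g3 - g2))"
    using gs(2) by simp
  moreover have "0 < g1" "g1 < g2" "g2 < g3"
    using gs(1) \<open>g0 = 0\<close> by (simp_all add: g)
  ultimately show ?thesis
    using that[of "g3 - g2" "g3 - g1" g3] by simp
qed

text \<open>The sum of squares serves twice: it makes the four gaps incongruent modulo 4, and it
  fixes the size of the resulting core.\<close>

lemma core4_with_parameters_exists:
  assumes "\<bar>\<gamma>\<bar> < \<beta>" "\<beta> < \<alpha>" "\<alpha>\<^sup>2 + \<beta>\<^sup>2 + \<gamma>\<^sup>2 = 8 * int m + 5"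
  obtains p where "p \<in> cores 4 m" "first_gaps 4 p = set (four_gaps \<alpha> \<beta> \<gamma>)"
proof -
  let ?G = "set (four_gaps \<alpha> \<beta> \<gamma>)"
  have "inj_on (\<lambda>g. g mod 4) ?G" and dist: "distinct (four_gaps \<alpha> \<beta> \<gamma>)"
    using residues_mod_4[OF assms(3)] distinct_map by blast+
  moreover from dist have "card ?G = 4"
    by (simp add: distinct_card four_gaps_def del: set_simps)
  moreover have "0 \<in> ?G" "\<forall>g \<in> ?G. 0 \<le> g" using assms by (auto simp: four_gaps_def)
  ultimately obtain p where p: "p \<in> cores 4 (sum_list p)" "first_gaps 4 p = ?G"
    using core_with_first_gaps_exists[of ?G 4] by auto
  then have "sum_list p = m" using core4_size[OF p dist] assms(3) by simp
  then show ?thesis using that p by simp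
qed

text \<open>The preimages have parameters \<open>\<alpha>, \<beta>, \<gamma>\<close> and
  \<open>\<alpha>, \<beta>, - \<gamma>\<close>, which differ because \<gamma> is positive.\<close>

lemma card_phi_fibre:
  assumes \<mu>: "\<mu> \<in> sc_cores 7 (8 * n + 1)" and n: "\<not> [n = 4] (mod 7)"
  shows "card {p \<in> cores 4 (7 * n + 2). phi p = \<mu>} = 2"
proof -
  obtain \<alpha> \<beta> \<gamma> where par: "0 < \<gamma>" "\<gamma> < \<beta>" "\<beta> < \<alpha>"
    and G: "first_gaps 7 \<mu> = set (seven_gaps \<alpha> \<beta> \<gamma>)"
    using sc_core7_parameters[OF \<mu>] .
  have \<mu>_core: "\<mu> \<in> cores 7 (8 * n + 1)" using \<mu> by (simp add: sc_cores_def)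
  have "\<alpha>\<^sup>2 + \<beta>\<^sup>2 + \<gamma>\<^sup>2 = 7 * int (8 * n + 1) + 14"
    using core7_size[OF \<mu>_core G] sorted_seven_gaps[OF par] by (simp add: strict_sorted_iff)
  then have sq: "\<alpha>\<^sup>2 + \<beta>\<^sup>2 + \<gamma>\<^sup>2 = 8 * int (7 * n + 2) + 5" by simp
  then have sq': "\<alpha>\<^sup>2 + \<beta>\<^sup>2 + (- \<gamma>)\<^sup>2 = 8 * int (7 * n + 2) + 5" by simp
  have fibre: "phi p = \<mu> \<longleftrightarrow>
      first_gaps 4 p = set (four_gaps \<alpha> \<beta> \<gamma>) \<or> first_gaps 4 p = set (four_gaps \<alpha> \<beta> (- \<gamma>))"
    if p: "p \<in> cores 4 (7 * n + 2)" for p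
  proof -
    obtain \<alpha>' \<beta>' \<gamma>' where par': "\<bar>\<gamma>'\<bar> < \<beta>'" "\<beta>' < \<alpha>'" "\<gamma>' \<noteq> 0"
      and F': "first_gaps 4 p = set (four_gaps \<alpha>' \<beta>' \<gamma>')"
      and G': "first_gaps 7 (phi p) = set (seven_gaps \<alpha>' \<beta>' \<gamma>')"
      and "phi p \<in> sc_cores 7 (8 * n + 1)"
      by (rule phi_parameters[OF p n]) (rule that; assumption)
    then have "phi p \<in> cores 7 (8 * n + 1)" by (simp add: sc_cores_def)
    then have "phi p = \<mu> \<longleftrightarrow> first_gaps 7 (phi p) = first_gaps 7 \<mu>"
      using first_gaps_inj \<mu>_core by (metis zero_less_numeral)
    \<comment> \<open>Passing to \<open>\<bar>\<gamma>'\<bar>\<close> keeps the set and puts the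
      parameters in the range where \<open>seven_gaps_inj\<close> applies.\<close>
    also have "\<dots> \<longleftrightarrow> set (seven_gaps \<alpha>' \<beta>' \<bar>\<gamma>'\<bar>) = set (seven_gaps \<alpha> \<beta> \<gamma>)"
      by (simp add: G G' abs_if set_seven_gaps_uminus)
    also have "\<dots> \<longleftrightarrow> \<alpha>' = \<alpha> \<and> \<beta>' = \<beta> \<and> \<bar>\<gamma>'\<bar> = \<gamma>"
      using seven_gaps_inj[of "\<bar>\<gamma>'\<bar>" \<beta>' \<alpha>' \<gamma> \<beta> \<alpha>] par par' by auto
    also have "\<dots> \<longleftrightarrow> \<alpha>' = \<alpha> \<and> \<beta>' = \<beta> \<and> (\<gamma>' = \<gamma> \<or> \<gamma>' = - \<gamma>)"
      using par(1) by auto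
    also have "\<dots> \<longleftrightarrow> set (four_gaps \<alpha>' \<beta>' \<gamma>') = set (four_gaps \<alpha> \<beta> \<gamma>) \<or>
        set (four_gaps \<alpha>' \<beta>' \<gamma>') = set (four_gaps \<alpha> \<beta> (- \<gamma>))"
      using four_gaps_inj[of \<gamma>' \<beta>' \<alpha>' \<gamma> \<beta> \<alpha>] four_gaps_inj[of \<gamma>' \<beta>' \<alpha>' "- \<gamma>" \<beta> \<alpha>] par par' by auto
    finally show ?thesis by (simp add: F')
  qed
  obtain p where p: "p \<in> cores 4 (7 * n + 2)" "first_gaps 4 p = set (four_gaps \<alpha> \<beta> \<gamma>)"
    using core4_with_parameters_exists[OF _ _ sq] par by auto
  obtain q where q: "q \<in> cores 4 (7 * n + 2)" "first_gaps 4 q = set (four_gaps \<alpha> \<beta> (- \<gamma>))"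
    using core4_with_parameters_exists[OF _ _ sq'] par by auto
  have "p \<noteq> q"
    using four_gaps_inj[of \<gamma> \<beta> \<alpha> "- \<gamma>" \<beta> \<alpha>] par p q by auto
  moreover have "{p \<in> cores 4 (7 * n + 2). phi p = \<mu>} = {p, q}"
  proof (intro set_eqI iffI)
    fix r assume "r \<in> {p \<in> cores 4 (7 * n + 2). phi p = \<mu>}"
    then have r: "r \<in> cores 4 (7 * n + 2)" "phi r = \<mu>" by auto
    then have "first_gaps 4 r = first_gaps 4 p \<or> first_gaps 4 r = first_gaps 4 q"
      using fibre p q by simp
    then show "r \<in> {p, q}"
      using first_gaps_inj[OF r(1) p(1)] first_gaps_inj[OF r(1) q(1)] by auto
  qed (use fibre p q in auto)
  ultimately show ?thesis by simp
qed

theorem theorem5p1: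
  fixes n :: nat
  assumes "\<not> [n = 4] (mod 7)"
  shows "(\<forall>p \<in> cores 4 (7 * n + 2).
            (\<forall>c \<in> set (C_elems p). c \<in> \<int> \<and> \<not> [\<lfloor>c\<rfloor> = 0] (mod 7)) \<and>
            distinct (map (\<lambda>c. \<lfloor>c\<rfloor> mod 7) (C_elems p)) \<and>
            map int (abacus 7 (phi p)) = phi_tuple p \<and>
            phi p \<in> sc_cores 7 (8 * n + 1)) \<and>
         (\<forall>\<mu> \<in> sc_cores 7 (8 * n + 1).
            card {p \<in> cores 4 (7 * n + 2). phi p = \<mu>} = 2)"
proof (intro conjI ballI)
  fix p assume p: "p \<in> cores 4 (7 * n + 2)"
  obtain cs where C: "C_elems p = map of_int cs"
    and res: "distinct (map (\<lambda>g. g mod 7) (0 # cs))"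
    and tuple: "map int (abacus 7 (phi p)) = phi_tuple p"
    and sc: "phi p \<in> sc_cores 7 (8 * n + 1)"
    using phi_parameters[OF p assms] by metis
  show "c \<in> \<int>" "\<not> [\<lfloor>c\<rfloor> = 0] (mod 7)" if "c \<in> set (C_elems p)" for c
    using that res by (auto simp: C cong_def image_iff)
  have "map (\<lambda>c. \<lfloor>c\<rfloor> mod 7) (C_elems p) = map (\<lambda>g. g mod 7) cs"
    by (simp add: C)
  then show "distinct (map (\<lambda>c. \<lfloor>c\<rfloor> mod 7) (C_elems p))"
    using res by simp
  show "map int (abacus 7 (phi p)) = phi_tuple p" "phi p \<in> sc_cores 7 (8 * n + 1)"
    by (fact tuple sc)+
qed (rule card_phi_fibre[OF _ assms])

end
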